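(* Let $k$ be a field of characteristic zero, $k[X]=k[x_0,x_1,\ldots,x_n]$, and let $d$ be the Weitzenböck derivation. For an arbitrary homogeneous isobaric polynomial $z\in k[X]^d$ with weight $\omega(z)$ and order $s$, the vector space $$V_m(z):=\langle v_0,v_1,\ldots,v_m\rangle,\qquad v_i=\frac{(\omega(z)-i)!}{i!\,(\omega(z))!}\,\hat d^{\,i}(z),\quad v_0:=z,\qquad m=0,\ldots,s,$$ is a $d$-module, and moreover $X_m\cong V_m(z)$.
   Context: The Weitzenböck derivation $d$ of $k[X]$ is the $k$-linear derivation with $d(x_0)=0$, $d(x_i)=x_{i-1}$ for $1\le i\le n$; $k[X]^d$ is its kernel. $\hat d$ is the $k$-linear derivation of $k[X]$ with $\hat d(x_i)=(i+1)(n-i)x_{i+1}$ for $0\le i<n$ and $\hat d(x_n)=0$. The weight of a monomial $x_0^{\alpha_0}x_1^{\alpha_1}\cdots x_n^{\alpha_n}$ is $n\sum_i\alpha_i-2(\alpha_1+2\alpha_2+\cdots+n\alpha_n)$; a homogeneous polynomial is isobaric if all its monomials have equal weight, and this common value is its weight $\omega(z)$. The order of $z$ is the smallest natural number $s$ (zero allowed) such that $\hat d^{\,s}(z)\ne0$ and $\hat d^{\,s+1}(z)=0$. A vector space $V$ is a $d$-module if $d(V)\subseteq V$; two $d$-modules are isomorphic ($\cong$) if there is a linear isomorphism between them commuting with $d$. $X_m$ is the vector space spanned by the elements $x_0,x_1,\ldots,x_m$, which is a $d$-module. *)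

theory Defs
  imports Complex_Main "HOL-Library.Poly_Mapping"
begin

section \<open>Polynomials in \<open>x\<^sub>0, \<dots>, x\<^sub>n\<close>\<close>

text \<open>
  A monomial is a finitely supported exponent function, a polynomial a finitely supported
  coefficient function on monomials; the ring operations are those of
  \<^theory>\<open>HOL-Library.Poly_Mapping\<close>.  The variables are indexed by all natural numbers, and
  \<open>polys n\<close> is the subring \<open>k[x\<^sub>0, \<dots>, x\<^sub>n]\<close>.
\<close>

type_synonym monomial = "nat \<Rightarrow>\<^sub>0 nat"
type_synonym 'k polynomial = "monomial \<Rightarrow>\<^sub>0 'k"

definition polys :: "nat \<Rightarrow> ('k::comm_ring_1) polynomial set" where
  "polys n = {p. \<forall>\<alpha>\<in>Poly_Mapping.keys p. Poly_Mapping.keys \<alpha> \<subseteq> {..n}}"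

definition X :: "nat \<Rightarrow> ('k::comm_ring_1) polynomial" where
  "X i = Poly_Mapping.single (Poly_Mapping.single i 1) 1"

text \<open>Scalars act through the constant polynomials, \<open>0\<close> being the exponent of the monomial \<open>1\<close>.\<close>

definition scale :: "'k::comm_ring_1 \<Rightarrow> 'k polynomial \<Rightarrow> 'k polynomial" where
  "scale c p = Poly_Mapping.single 0 c * p"

global_interpretation polyspace: vector_space "scale :: 'k::field \<Rightarrow> _"
  defines poly_span = polyspace.span
    and poly_subspace = polyspace.subspace
proof
  fix a b :: 'k and x y :: "'k polynomial"
  show "scale a (x + y) = scale a x + scale a y"
    by (simp add: scale_def distrib_left)
  show "scale (a + b) x = scale a x + scale b x"
    by (simp add: scale_def single_add distrib_right)
  show "scale a (scale b x) = scale (a * b) x"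
    by (simp add: scale_def mult.assoc[symmetric] mult_single)
  show "scale 1 x = x"
    by (simp add: scale_def)
qed


section \<open>Derivations\<close>

definition is_derivation :: "nat \<Rightarrow> ('k::field polynomial \<Rightarrow> 'k polynomial) \<Rightarrow> bool" where
  "is_derivation n D \<longleftrightarrow>
     (\<forall>p\<in>polys n. D p \<in> polys n) \<and>
     (\<forall>p\<in>polys n. \<forall>q\<in>polys n. D (p + q) = D p + D q) \<and>
     (\<forall>c. \<forall>p\<in>polys n. D (scale c p) = scale c (D p)) \<and>
     (\<forall>p\<in>polys n. \<forall>q\<in>polys n. D (p * q) = D p * q + p * D q)"

definition is_weitzenboeck :: "nat \<Rightarrow> ('k::field polynomial \<Rightarrow> 'k polynomial) \<Rightarrow> bool" where
  "is_weitzenboeck n d \<longleftrightarrow>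
     is_derivation n d \<and> d (X 0) = 0 \<and> (\<forall>i\<in>{1..n}. d (X i) = X (i - 1))"

definition is_hat_derivation :: "nat \<Rightarrow> ('k::field polynomial \<Rightarrow> 'k polynomial) \<Rightarrow> bool" where
  "is_hat_derivation n dh \<longleftrightarrow>
     is_derivation n dh \<and>
     (\<forall>i<n. dh (X i) = scale (of_nat ((i + 1) * (n - i))) (X (i + 1))) \<and> dh (X n) = 0"


section \<open>Weight and order\<close>

definition monomial_degree :: "monomial \<Rightarrow> nat" where
  "monomial_degree \<alpha> = (\<Sum>i\<in>Poly_Mapping.keys \<alpha>. Poly_Mapping.lookup \<alpha> i)"

definition monomial_weight :: "nat \<Rightarrow> monomial \<Rightarrow> int" where
  "monomial_weight n \<alpha> =
     int n * (\<Sum>i=0..n. int (Poly_Mapping.lookup \<alpha> i)) - 2 * (\<Sum>i=1..n. int i * int (Poly_Mapping.lookup \<alpha> i))"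

definition homogeneous :: "('k::comm_ring_1) polynomial \<Rightarrow> bool" where
  "homogeneous z \<longleftrightarrow> (\<forall>\<alpha>\<in>Poly_Mapping.keys z. \<forall>\<beta>\<in>Poly_Mapping.keys z. monomial_degree \<alpha> = monomial_degree \<beta>)"

definition isobaric :: "nat \<Rightarrow> ('k::comm_ring_1) polynomial \<Rightarrow> bool" where
  "isobaric n z \<longleftrightarrow> homogeneous z \<and>
     (\<forall>\<alpha>\<in>Poly_Mapping.keys z. \<forall>\<beta>\<in>Poly_Mapping.keys z. monomial_weight n \<alpha> = monomial_weight n \<beta>)"

text \<open>The common weight of the monomials; meaningful for nonzero isobaric \<open>z\<close> only.\<close>

definition weight :: "nat \<Rightarrow> ('k::comm_ring_1) polynomial \<Rightarrow> int" where
  "weight n z = (THE w. \<forall>\<alpha>\<in>Poly_Mapping.keys z. monomial_weight n \<alpha> = w)"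

text \<open>The order with respect to the derivation \<open>dh\<close>; meaningful for nonzero \<open>z\<close> only.\<close>

definition poly_order :: "('k::comm_ring_1 polynomial \<Rightarrow> 'k polynomial) \<Rightarrow> 'k polynomial \<Rightarrow> nat" where
  "poly_order dh z = (LEAST s. (dh ^^ s) z \<noteq> 0 \<and> (dh ^^ (s + 1)) z = 0)"


section \<open>d-modules\<close>

definition d_module ::
    "('k::field polynomial \<Rightarrow> 'k polynomial) \<Rightarrow> 'k polynomial set \<Rightarrow> bool" where
  "d_module d V \<longleftrightarrow> poly_subspace V \<and> d ` V \<subseteq> V"

text \<open>
  The two modules carry their own operators, since they may lie in polynomial rings with
  different numbers of variables.
\<close>

definition d_module_iso ::
    "('k::field polynomial \<Rightarrow> 'k polynomial) \<Rightarrow> 'k polynomial set \<Rightarrow>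
     ('k polynomial \<Rightarrow> 'k polynomial) \<Rightarrow> 'k polynomial set \<Rightarrow> bool" where
  "d_module_iso d V d' W \<longleftrightarrow>
     d_module d V \<and> d_module d' W \<and>
     (\<exists>f. bij_betw f V W \<and>
        (\<forall>u\<in>V. \<forall>v\<in>V. f (u + v) = f u + f v) \<and>
        (\<forall>c. \<forall>v\<in>V. f (scale c v) = scale c (f v)) \<and>
        (\<forall>v\<in>V. f (d v) = d' (f v)))"

definition X_module :: "nat \<Rightarrow> ('k::field) polynomial set" where
  "X_module m = poly_span (X ` {0..m})"

text \<open>
  The weight is an integer, hence the conversion to \<open>nat\<close> inside the factorials; for nonzero
  isobaric \<open>z\<close> in the kernel of \<open>d\<close> and \<open>i\<close> at most the order, nothing is truncated.
\<close>

definition v_elem ::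
    "nat \<Rightarrow> ('k::field_char_0 polynomial \<Rightarrow> 'k polynomial) \<Rightarrow> 'k polynomial \<Rightarrow> nat \<Rightarrow> 'k polynomial"
  where
  "v_elem n dh z i =
     scale (fact (nat (weight n z - int i)) / (fact i * fact (nat (weight n z)))) ((dh ^^ i) z)"

definition V_module ::
    "nat \<Rightarrow> ('k::field_char_0 polynomial \<Rightarrow> 'k polynomial) \<Rightarrow> 'k polynomial \<Rightarrow> nat \<Rightarrow> 'k polynomial set"
  where
  "V_module n dh z m = poly_span (v_elem n dh z ` {0..m})"


section \<open>Existence of derivations with prescribed values\<close>

lemma polys_0: "0 \<in> polys n"
  by (simp add: polys_def)

lemma polys_add:
  assumes "p \<in> polys n" "q \<in> polys n"
  shows "p + q \<in> polys n"
  using assms Poly_Mapping.keys_add[of p q] by (auto simp: polys_def)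

lemma keys_monomial_add: "Poly_Mapping.keys (\<alpha> + \<beta> :: monomial) = Poly_Mapping.keys \<alpha> \<union> Poly_Mapping.keys \<beta>"
  by (auto simp: in_keys_iff lookup_add)

lemma polys_mult:
  assumes "p \<in> polys n" "q \<in> polys n"
  shows "p * q \<in> polys n"
proof -
  have "Poly_Mapping.keys \<gamma> \<subseteq> {..n}" if \<gamma>: "\<gamma> \<in> Poly_Mapping.keys (p * q)" for \<gamma>
  proof -
    obtain \<alpha> \<beta> where "\<gamma> = \<alpha> + \<beta>" "\<alpha> \<in> Poly_Mapping.keys p" "\<beta> \<in> Poly_Mapping.keys q"
      using \<gamma> Poly_Mapping.keys_mult[of p q] by blast
    then show ?thesis
      using assms keys_monomial_add[of \<alpha> \<beta>] by (auto simp: polys_def)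
  qed
  then show ?thesis
    by (auto simp: polys_def)
qed

lemma polys_sum: "(\<And>i. i \<in> I \<Longrightarrow> f i \<in> polys n) \<Longrightarrow> sum f I \<in> polys n"
  by (induction I rule: infinite_finite_induct) (auto simp: polys_0 polys_add)

lemma polys_single: "Poly_Mapping.keys \<alpha> \<subseteq> {..n} \<Longrightarrow> Poly_Mapping.single \<alpha> c \<in> polys n"
  by (simp add: polys_def)

lemma polynomial_expansion:
  fixes p :: "'k::comm_ring_1 polynomial"
  shows "p = (\<Sum>\<alpha>\<in>Poly_Mapping.keys p. Poly_Mapping.single \<alpha> (Poly_Mapping.lookup p \<alpha>))"
proof (rule poly_mapping_eqI)
  fix \<beta>
  have "Poly_Mapping.lookup (\<Sum>\<alpha>\<in>Poly_Mapping.keys p. Poly_Mapping.single \<alpha> (Poly_Mapping.lookup p \<alpha>)) \<beta>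
      = (\<Sum>\<alpha>\<in>Poly_Mapping.keys p. if \<alpha> = \<beta> then Poly_Mapping.lookup p \<alpha> else 0)"
    by (simp add: lookup_sum lookup_single when_def)
  also have "\<dots> = Poly_Mapping.lookup p \<beta>"
    by (simp add: sum.delta in_keys_iff)
  finally show "Poly_Mapping.lookup p \<beta> = Poly_Mapping.lookup (\<Sum>\<alpha>\<in>Poly_Mapping.keys p. Poly_Mapping.single \<alpha> (Poly_Mapping.lookup p \<alpha>)) \<beta>"
    by simp
qed

lemma polynomial_induct [case_names zero single add]:
  fixes p :: "'k::comm_ring_1 polynomial"
  assumes "P 0" "\<And>\<alpha> c. P (Poly_Mapping.single \<alpha> c)" "\<And>p q. P p \<Longrightarrow> P q \<Longrightarrow> P (p + q)"
  shows "P p"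
proof -
  have "P (\<Sum>\<alpha>\<in>A. Poly_Mapping.single \<alpha> (Poly_Mapping.lookup p \<alpha>))" for A
    by (induction A rule: infinite_finite_induct) (auto intro: assms)
  then show ?thesis
    using polynomial_expansion[of p] by metis
qed

definition monomial_derivation ::
    "(nat \<Rightarrow> 'k::field polynomial) \<Rightarrow> monomial \<Rightarrow> 'k polynomial" where
  "monomial_derivation f \<alpha> =
     (\<Sum>i\<in>Poly_Mapping.keys \<alpha>. Poly_Mapping.single (\<alpha> - Poly_Mapping.single i 1) (of_nat (Poly_Mapping.lookup \<alpha> i)) * f i)"

definition derivation_of ::
    "(nat \<Rightarrow> 'k::field polynomial) \<Rightarrow> 'k polynomial \<Rightarrow> 'k polynomial" where
  "derivation_of f p = (\<Sum>\<alpha>\<in>Poly_Mapping.keys p. scale (Poly_Mapping.lookup p \<alpha>) (monomial_derivation f \<alpha>))"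

lemma monomial_derivation_superset:
  assumes "finite S" "Poly_Mapping.keys \<alpha> \<subseteq> S"
  shows "monomial_derivation f \<alpha> =
    (\<Sum>i\<in>S. Poly_Mapping.single (\<alpha> - Poly_Mapping.single i 1) (of_nat (Poly_Mapping.lookup \<alpha> i)) * f i)"
  unfolding monomial_derivation_def
  by (rule sum.mono_neutral_left) (use assms in \<open>auto simp: in_keys_iff\<close>)

lemma derivation_of_superset:
  assumes "finite S" "Poly_Mapping.keys p \<subseteq> S"
  shows "derivation_of f p = (\<Sum>\<alpha>\<in>S. scale (Poly_Mapping.lookup p \<alpha>) (monomial_derivation f \<alpha>))"
  unfolding derivation_of_def
  by (rule sum.mono_neutral_left) (use assms in \<open>auto simp: in_keys_iff scale_def\<close>)

lemma derivation_of_single: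
  "derivation_of f (Poly_Mapping.single \<alpha> c) = scale c (monomial_derivation f \<alpha>)"
  by (subst derivation_of_superset[of "{\<alpha>}"]) auto

lemma derivation_of_add: "derivation_of f (p + q) = derivation_of f p + derivation_of f q"
proof -
  let ?S = "Poly_Mapping.keys p \<union> Poly_Mapping.keys q"
  have "derivation_of f (p + q) = (\<Sum>\<alpha>\<in>?S. scale (Poly_Mapping.lookup (p + q) \<alpha>) (monomial_derivation f \<alpha>))"
    by (rule derivation_of_superset) (use Poly_Mapping.keys_add[of p q] in auto)
  moreover have "derivation_of f p = (\<Sum>\<alpha>\<in>?S. scale (Poly_Mapping.lookup p \<alpha>) (monomial_derivation f \<alpha>))"
    and "derivation_of f q = (\<Sum>\<alpha>\<in>?S. scale (Poly_Mapping.lookup q \<alpha>) (monomial_derivation f \<alpha>))"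
    by (rule derivation_of_superset; auto)+
  ultimately show ?thesis
    by (simp add: lookup_add polyspace.scale_left_distrib sum.distrib)
qed

lemma derivation_of_0: "derivation_of f 0 = 0"
  by (simp add: derivation_of_def)

lemma shift_single:
  fixes \<alpha> \<beta> :: monomial
  shows "Poly_Mapping.single (\<alpha> + \<beta> - Poly_Mapping.single i 1) (of_nat (Poly_Mapping.lookup \<alpha> i) :: 'k::field) =
    Poly_Mapping.single \<beta> 1 * Poly_Mapping.single (\<alpha> - Poly_Mapping.single i 1) (of_nat (Poly_Mapping.lookup \<alpha> i))"
proof (cases "Poly_Mapping.lookup \<alpha> i = 0")
  case False
  have "\<alpha> + \<beta> - Poly_Mapping.single i 1 = \<beta> + (\<alpha> - Poly_Mapping.single i 1)"
    by (rule poly_mapping_eqI)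
      (use False in \<open>auto simp: lookup_add lookup_minus lookup_single when_def\<close>)
  then show ?thesis
    by (simp add: mult_single)
qed simp

lemma monomial_derivation_add:
  "monomial_derivation f (\<alpha> + \<beta>) =
     Poly_Mapping.single \<beta> 1 * monomial_derivation f \<alpha> +
     Poly_Mapping.single \<alpha> 1 * monomial_derivation f \<beta>"
proof -
  let ?S = "Poly_Mapping.keys \<alpha> \<union> Poly_Mapping.keys \<beta>"
  let ?e = "\<lambda>i. Poly_Mapping.single i (1::nat)"
  have "Poly_Mapping.single (\<alpha> + \<beta> - ?e i) (of_nat (Poly_Mapping.lookup (\<alpha> + \<beta>) i)) * f i =
      Poly_Mapping.single \<beta> 1 * (Poly_Mapping.single (\<alpha> - ?e i) (of_nat (Poly_Mapping.lookup \<alpha> i)) * f i) +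
      Poly_Mapping.single \<alpha> 1 * (Poly_Mapping.single (\<beta> - ?e i) (of_nat (Poly_Mapping.lookup \<beta> i)) * f i)" for i
    using shift_single[of \<alpha> \<beta> i, where ?'k = 'a] shift_single[of \<beta> \<alpha> i, where ?'k = 'a]
    by (simp add: lookup_add single_add distrib_right mult.assoc add.commute[of \<beta> \<alpha>])
  moreover have "monomial_derivation f (\<alpha> + \<beta>) =
      (\<Sum>i\<in>?S. Poly_Mapping.single (\<alpha> + \<beta> - ?e i) (of_nat (Poly_Mapping.lookup (\<alpha> + \<beta>) i)) * f i)"
    by (rule monomial_derivation_superset) (auto simp: keys_monomial_add)
  moreover have
    "monomial_derivation f \<alpha> = (\<Sum>i\<in>?S. Poly_Mapping.single (\<alpha> - ?e i) (of_nat (Poly_Mapping.lookup \<alpha> i)) * f i)"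
    "monomial_derivation f \<beta> = (\<Sum>i\<in>?S. Poly_Mapping.single (\<beta> - ?e i) (of_nat (Poly_Mapping.lookup \<beta> i)) * f i)"
    by (rule monomial_derivation_superset; auto)+
  ultimately show ?thesis
    by (simp add: sum.distrib sum_distrib_left)
qed

lemma derivation_of_mult:
  "derivation_of f (p * q) = derivation_of f p * q + p * derivation_of f q"
proof (induction p rule: polynomial_induct)
  case (single \<alpha> a)
  show ?case
  proof (induction q rule: polynomial_induct)
    case (single \<beta> b)
    have s: "Poly_Mapping.single \<gamma> c = scale c (Poly_Mapping.single \<gamma> 1)" for \<gamma> :: monomial and c :: 'a
      by (simp add: scale_def mult_single)
    have "derivation_of f (Poly_Mapping.single \<alpha> a * Poly_Mapping.single \<beta> b) =
        Poly_Mapping.single 0 (a * b) * monomial_derivation f (\<alpha> + \<beta>)"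
      by (simp add: mult_single derivation_of_single scale_def)
    also have "\<dots> = Poly_Mapping.single 0 a * Poly_Mapping.single 0 b * monomial_derivation f (\<alpha> + \<beta>)"
      by (simp add: mult_single)
    also have "\<dots> = scale a (monomial_derivation f \<alpha>) * scale b (Poly_Mapping.single \<beta> 1) +
        scale a (Poly_Mapping.single \<alpha> 1) * scale b (monomial_derivation f \<beta>)"
      by (simp add: monomial_derivation_add scale_def algebra_simps del: single_one)
    finally show ?case
      by (simp only: derivation_of_single s[symmetric])
  qed (simp_all add: derivation_of_0 derivation_of_add algebra_simps)
qed (simp_all add: derivation_of_0 derivation_of_add algebra_simps)

lemma derivation_of_scale: "derivation_of f (scale c p) = scale c (derivation_of f p)"
proof -
  have "derivation_of f (Poly_Mapping.single 0 c) = 0"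
    by (simp add: derivation_of_single monomial_derivation_def)
  then show ?thesis
    by (simp add: scale_def derivation_of_mult)
qed

lemma derivation_of_X: "derivation_of f (X i) = f i"
  by (simp add: X_def derivation_of_single monomial_derivation_def)

lemma derivation_of_polys:
  assumes f: "\<And>i. i \<le> n \<Longrightarrow> f i \<in> polys n" and p: "p \<in> polys n"
  shows "derivation_of f p \<in> polys n"
  unfolding derivation_of_def scale_def monomial_derivation_def
proof (intro polys_sum polys_mult polys_single f)
  fix \<alpha> i assume "\<alpha> \<in> Poly_Mapping.keys p" "i \<in> Poly_Mapping.keys \<alpha>"
  then have *: "Poly_Mapping.keys \<alpha> \<subseteq> {..n}"
    using p by (auto simp: polys_def)
  then show "i \<le> n"
    using \<open>i \<in> Poly_Mapping.keys \<alpha>\<close> by auto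
  show "Poly_Mapping.keys (\<alpha> - Poly_Mapping.single i 1) \<subseteq> {..n}"
    using * by (auto simp: in_keys_iff lookup_minus subset_iff)
qed simp

lemma is_derivation_derivation_of:
  "(\<And>i. i \<le> n \<Longrightarrow> f i \<in> polys n) \<Longrightarrow> is_derivation n (derivation_of f)"
  by (simp add: is_derivation_def derivation_of_polys derivation_of_add derivation_of_scale
      derivation_of_mult)

lemma X_polys: "i \<le> n \<Longrightarrow> X i \<in> polys n"
  by (simp add: X_def polys_def)

lemma weitzenboeck_exists:
  "\<exists>d :: 'k::field polynomial \<Rightarrow> 'k polynomial. is_weitzenboeck n d"
  unfolding is_weitzenboeck_def
  by (rule exI[of _ "derivation_of (\<lambda>i. if i = 0 then 0 else X (i - 1))"])
    (auto simp: derivation_of_X intro!: is_derivation_derivation_of X_polys polys_0)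

lemma hat_derivation_exists:
  "\<exists>dh :: 'k::field polynomial \<Rightarrow> 'k polynomial. is_hat_derivation n dh"
  unfolding is_hat_derivation_def
  by (rule exI[of _ "derivation_of (\<lambda>i. if i < n then scale (of_nat ((i + 1) * (n - i))) (X (i + 1)) else 0)"])
    (auto simp: derivation_of_X scale_def
      intro!: is_derivation_derivation_of X_polys polys_0 polys_mult polys_single)

end

theory Submission
  imports Defs
begin

text \<open>
  The derivations \<open>d\<close> and \<open>dh\<close> are the raising and lowering operators of an \<open>sl\<^sub>2\<close>-action on
  \<open>k[x\<^sub>0, \<dots>, x\<^sub>n]\<close>: their commutator is the derivation \<open>h\<close> with \<open>h(x\<^sub>i) = (n - 2 i) x\<^sub>i\<close>, which
  multiplies every monomial by its weight.  Identities of this kind hold between derivations, so it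
  is enough to check them on the variables (\<open>derivations_eqI\<close>).

  An isobaric polynomial \<open>z\<close> killed by \<open>d\<close> is thus a highest weight vector, of weight \<open>w\<close>
  say, and the familiar computation (\<open>weitzenboeck_funpow_hat\<close>) gives
  \<open>d (dh\<^sup>i\<^sup>+\<^sup>1 z) = (i + 1) (w - i) dh\<^sup>i z\<close>.
  The operator \<open>dh\<close> is nilpotent on \<open>z\<close> because it lowers by one the grade in which
  \<open>x\<^sub>i\<close> counts \<open>n - i\<close>, and no monomial has a negative grade.  Hence \<open>z\<close> has an order
  \<open>s\<close> in the proper sense, and the formula for \<open>i = s\<close> reads
  \<open>0 = (s + 1) (w - s) dh\<^sup>s z\<close> with \<open>dh\<^sup>s z \<noteq> 0\<close>.  In characteristic zero this forces
  \<open>w = s\<close> (\<open>poly_order_eq_weight\<close>).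

  Consequently \<open>w - i\<close> is a natural number for all \<open>i \<le> s\<close>, and the factorials in \<open>v\<^sub>i\<close> are
  exactly those which turn the formula into \<open>d v\<^sub>i\<^sub>+\<^sub>1 = v\<^sub>i\<close>, \<open>d v\<^sub>0 = 0\<close>.  So both
  \<open>x\<^sub>0, \<dots>, x\<^sub>m\<close> and \<open>v\<^sub>0, \<dots>, v\<^sub>m\<close> are Jordan chains of length \<open>m + 1\<close> for the eigenvalue \<open>0\<close>.
  A Jordan chain that starts with a nonzero vector is linearly independent, and the operator acts on
  coordinates by a shift which depends on the length only; sending one chain to the other is
  therefore an isomorphism (\<open>jordan_chains_isomorphic\<close>).
\<close>


section \<open>Derivations are determined by the variables\<close>

lemma scale_mult_left: "scale c p * q = scale c (p * q)"
  by (simp add: scale_def mult.assoc)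

lemma scale_mult_right: "p * scale c q = scale c (p * q)"
  by (simp add: scale_def ac_simps)

lemma polys_subspace: "poly_subspace (polys n)"
  unfolding polyspace.subspace_def scale_def
  by (auto intro!: polys_0 polys_add polys_mult polys_single)

lemmas polys_scale = polyspace.subspace_scale[OF polys_subspace]
lemmas polys_diff = polyspace.subspace_diff[OF polys_subspace]

lemma polys_1: "1 \<in> polys n"
  using polys_single[of 0 n 1] by simp

lemma single_in_polys_induct:
  fixes c :: "'k::field"
  assumes keys: "Poly_Mapping.keys \<alpha> \<subseteq> {..n}"
    and const: "\<And>c. P (scale c 1)"
    and mult: "\<And>i p. i \<le> n \<Longrightarrow> p \<in> polys n \<Longrightarrow> P p \<Longrightarrow> P (X i * p)"
  shows "P (Poly_Mapping.single \<alpha> c)"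
  using keys
proof (induction "monomial_degree \<alpha>" arbitrary: \<alpha> rule: less_induct)
  case less
  show ?case
  proof (cases "\<alpha> = 0")
    case True
    then show ?thesis
      using const[of c] by (simp add: scale_def)
  next
    case False
    then obtain i where i: "i \<in> Poly_Mapping.keys \<alpha>"
      by fastforce
    define \<beta> where "\<beta> = \<alpha> - Poly_Mapping.single i 1"
    have eq: "\<alpha> = Poly_Mapping.single i 1 + \<beta>"
      by (rule poly_mapping_eqI)
        (use i in \<open>auto simp: \<beta>_def lookup_add lookup_minus lookup_single when_def in_keys_iff\<close>)
    have sub: "Poly_Mapping.keys \<beta> \<subseteq> Poly_Mapping.keys \<alpha>"
      using keys_monomial_add[of "Poly_Mapping.single i 1" \<beta>] eq by auto
    have "monomial_degree \<beta> = (\<Sum>j\<in>Poly_Mapping.keys \<alpha>. Poly_Mapping.lookup \<beta> j)"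
      unfolding monomial_degree_def
      by (rule sum.mono_neutral_left) (use sub in \<open>auto simp: in_keys_iff\<close>)
    also have "\<dots> < monomial_degree \<alpha>"
      unfolding monomial_degree_def
      by (rule sum_strict_mono_ex1)
        (use i in \<open>auto simp: \<beta>_def lookup_minus lookup_single when_def in_keys_iff\<close>)
    finally have "P (Poly_Mapping.single \<beta> c)"
      using less sub by blast
    moreover have "Poly_Mapping.single \<alpha> c = X i * Poly_Mapping.single \<beta> c"
      by (simp add: X_def mult_single eq)
    ultimately show ?thesis
      using i less.prems sub by (auto intro!: mult polys_single)
  qed
qed

lemma polys_induct [consumes 1, case_names const add mult]:
  fixes p :: "'k::field polynomial"
  assumes p: "p \<in> polys n"
    and const: "\<And>c. P (scale c 1)"
    and add: "\<And>p q. p \<in> polys n \<Longrightarrow> q \<in> polys n \<Longrightarrow> P p \<Longrightarrow> P q \<Longrightarrow> P (p + q)"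
    and mult: "\<And>i p. i \<le> n \<Longrightarrow> p \<in> polys n \<Longrightarrow> P p \<Longrightarrow> P (X i * p)"
  shows "P p"
proof -
  let ?t = "\<lambda>\<alpha>. Poly_Mapping.single \<alpha> (Poly_Mapping.lookup p \<alpha>)"
  have "P (sum ?t A) \<and> sum ?t A \<in> polys n" if "finite A" "A \<subseteq> Poly_Mapping.keys p" for A
    using that
  proof (induction A rule: finite_induct)
    case empty
    then show ?case
      using const[of 0] by (simp add: polys_0)
  next
    case (insert \<alpha> A)
    have "Poly_Mapping.keys \<alpha> \<subseteq> {..n}"
      using p insert.prems by (auto simp: polys_def)
    then show ?case
      using insert by (auto intro!: add polys_add polys_single single_in_polys_induct[of \<alpha> n P] const mult)
  qed
  from this[OF finite_keys order_refl] show ?thesis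
    using polynomial_expansion[of p] by simp
qed

context
  fixes n :: nat and D :: "'k::field polynomial \<Rightarrow> 'k polynomial"
  assumes D: "is_derivation n D"
begin

lemma derivation_closed: "p \<in> polys n \<Longrightarrow> D p \<in> polys n"
  and derivation_add: "p \<in> polys n \<Longrightarrow> q \<in> polys n \<Longrightarrow> D (p + q) = D p + D q"
  and derivation_scale: "p \<in> polys n \<Longrightarrow> D (scale c p) = scale c (D p)"
  and derivation_mult: "p \<in> polys n \<Longrightarrow> q \<in> polys n \<Longrightarrow> D (p * q) = D p * q + p * D q"
  using D by (auto simp: is_derivation_def)

lemma derivation_0: "D 0 = 0"
  using derivation_scale[OF polys_0, of 0] by simp

lemma derivation_1: "D 1 = 0"
proof -
  have "D 1 + D 1 = D 1"
    using derivation_mult[OF polys_1 polys_1] by (simp only: mult_1_left mult_1_right)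
  then show ?thesis
    by (simp only: add_cancel_left_left)
qed

lemma derivation_sum:
  "(\<And>i. i \<in> I \<Longrightarrow> f i \<in> polys n) \<Longrightarrow> D (sum f I) = (\<Sum>i\<in>I. D (f i))"
  by (induction I rule: infinite_finite_induct) (auto simp: derivation_0 derivation_add polys_sum)

lemma derivation_funpow_closed: "p \<in> polys n \<Longrightarrow> (D ^^ i) p \<in> polys n"
  by (induction i) (auto simp: derivation_closed)

end

text \<open>
  Derivations kill the constants, and the product rule propagates an agreement on the variables to
  the algebra which they generate.
\<close>

lemma derivations_eqI:
  assumes D: "is_derivation n D" and E: "is_derivation n E"
    and X: "\<And>i. i \<le> n \<Longrightarrow> D (X i) = E (X i)" and p: "p \<in> polys n"
  shows "D p = E p"
  using p
proof (induction rule: polys_induct)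
  case (const c)
  then show ?case
    by (simp add: derivation_scale[OF D polys_1] derivation_scale[OF E polys_1]
        derivation_1[OF D] derivation_1[OF E])
qed (simp_all add: derivation_add[OF D] derivation_add[OF E] derivation_mult[OF D]
    derivation_mult[OF E] X X_polys)

text \<open>The mixed terms \<open>D p * E q + E p * D q\<close> of the two compositions cancel.\<close>

lemma is_derivation_commutator:
  assumes D: "is_derivation n D" and E: "is_derivation n E"
  shows "is_derivation n (\<lambda>p. D (E p) - E (D p))"
proof -
  note closed = derivation_closed[OF D] derivation_closed[OF E]
  note linear = derivation_add[OF D] derivation_add[OF E] derivation_scale[OF D] derivation_scale[OF E]
  note mult = derivation_mult[OF D] derivation_mult[OF E]
  show ?thesis
    unfolding is_derivation_def
  proof (intro conjI ballI allI)
    show "D (E (scale c p)) - E (D (scale c p)) = scale c (D (E p) - E (D p))" if "p \<in> polys n" for c p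
      using that by (simp add: closed linear polyspace.scale_right_diff_distrib)
    show "D (E (p * q)) - E (D (p * q)) = (D (E p) - E (D p)) * q + p * (D (E q) - E (D q))"
      if "p \<in> polys n" "q \<in> polys n" for p q
      using that by (simp add: closed linear mult polys_mult left_diff_distrib right_diff_distrib)
  qed (simp_all add: closed linear polys_diff)
qed

lemma is_derivation_scale:
  assumes D: "is_derivation n D"
  shows "is_derivation n (\<lambda>p. scale b (D p))"
  unfolding is_derivation_def
  by (simp add: derivation_closed[OF D] derivation_add[OF D] derivation_scale[OF D]
      derivation_mult[OF D] polys_scale polyspace.scale_right_distrib scale_mult_left
      scale_mult_right mult.commute)


section \<open>Grading derivations\<close>

text \<open>
  The Euler operators that are needed assign to \<open>x\<^sub>i\<close> a value affine in \<open>i\<close>.  These are the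
  gradings in which \<open>dh\<close> is homogeneous: it moves \<open>x\<^sub>i\<close> to \<open>x\<^sub>i\<^sub>+\<^sub>1\<close> and so shifts the grade by the
  slope \<open>b\<close>.  The weight is the case \<open>a = n\<close>, \<open>b = -2\<close>.
\<close>

definition grading_derivation :: "'k::field \<Rightarrow> 'k \<Rightarrow> 'k polynomial \<Rightarrow> 'k polynomial" where
  "grading_derivation a b = derivation_of (\<lambda>i. scale (a + b * of_nat i) (X i))"

definition grade :: "'k::field \<Rightarrow> 'k \<Rightarrow> monomial \<Rightarrow> 'k" where
  "grade a b \<alpha> = (\<Sum>i\<in>Poly_Mapping.keys \<alpha>. (a + b * of_nat i) * of_nat (Poly_Mapping.lookup \<alpha> i))"

lemma is_derivation_grading: "is_derivation n (grading_derivation a b)"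
  unfolding grading_derivation_def
  by (intro is_derivation_derivation_of polys_scale X_polys)

lemma grading_derivation_X: "grading_derivation a b (X i) = scale (a + b * of_nat i) (X i)"
  by (simp add: grading_derivation_def derivation_of_X)

text \<open>
  Differentiating by \<open>x\<^sub>i\<close> and multiplying by \<open>x\<^sub>i\<close> again restores the monomial and leaves its
  exponent of \<open>x\<^sub>i\<close> as a factor.
\<close>

lemma grading_derivation_single:
  "grading_derivation a b (Poly_Mapping.single \<alpha> c) = scale (grade a b \<alpha>) (Poly_Mapping.single \<alpha> c)"
proof -
  let ?e = "\<lambda>i. Poly_Mapping.single i (1::nat)"
  have "Poly_Mapping.single (\<alpha> - ?e i) (of_nat (Poly_Mapping.lookup \<alpha> i)) * scale (a + b * of_nat i) (X i)
      = Poly_Mapping.single \<alpha> ((a + b * of_nat i) * of_nat (Poly_Mapping.lookup \<alpha> i))"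
    if "i \<in> Poly_Mapping.keys \<alpha>" for i
  proof -
    have "\<alpha> - ?e i + ?e i = \<alpha>"
      by (rule poly_mapping_eqI)
        (use that in \<open>auto simp: lookup_add lookup_minus lookup_single when_def in_keys_iff\<close>)
    then show ?thesis
      by (simp add: scale_def X_def mult_single ac_simps)
  qed
  moreover have "(\<Sum>i\<in>I. Poly_Mapping.single \<alpha> (f i)) = Poly_Mapping.single \<alpha> (sum f I)"
    for I :: "nat set" and f :: "nat \<Rightarrow> 'a"
    by (induction I rule: infinite_finite_induct) (auto simp: single_add)
  ultimately have "monomial_derivation (\<lambda>i. scale (a + b * of_nat i) (X i)) \<alpha>
      = Poly_Mapping.single \<alpha> (grade a b \<alpha>)"
    unfolding monomial_derivation_def grade_def by simp
  then show ?thesis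
    by (simp add: grading_derivation_def derivation_of_single scale_def mult_single mult.commute)
qed

lemma lookup_scale: "Poly_Mapping.lookup (scale c p) \<alpha> = c * Poly_Mapping.lookup p \<alpha>"
proof (induction p rule: polynomial_induct)
  case (single \<beta> b)
  then show ?case
    by (simp add: scale_def mult_single lookup_single when_def)
qed (simp_all add: scale_def distrib_left lookup_add)

lemma lookup_grading_derivation:
  "Poly_Mapping.lookup (grading_derivation a b p) \<alpha> = grade a b \<alpha> * Poly_Mapping.lookup p \<alpha>"
proof (induction p rule: polynomial_induct)
  case zero
  then show ?case
    by (simp add: grading_derivation_def derivation_of_0)
next
  case (single \<beta> c)
  then show ?case
    by (simp add: grading_derivation_single lookup_scale lookup_single when_def)
next
  case (add p q)
  then show ?case
    by (simp add: grading_derivation_def derivation_of_add lookup_add distrib_left)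
qed

lemma grading_eigenvector_iff:
  "grading_derivation a b p = scale l p \<longleftrightarrow> (\<forall>\<alpha>\<in>Poly_Mapping.keys p. grade a b \<alpha> = l)"
  by (auto simp: poly_mapping_eq_iff fun_eq_iff lookup_grading_derivation lookup_scale in_keys_iff)

lemma grade_monomial_weight:
  assumes "Poly_Mapping.keys \<alpha> \<subseteq> {..n}"
  shows "grade (of_nat n) (-2) \<alpha> = (of_int (monomial_weight n \<alpha>) :: 'k::field)"
proof -
  let ?l = "\<lambda>i. of_nat (Poly_Mapping.lookup \<alpha> i) :: 'k"
  have "(\<Sum>i=1..n. int i * int (Poly_Mapping.lookup \<alpha> i)) =
      (\<Sum>i=0..n. int i * int (Poly_Mapping.lookup \<alpha> i))"
    by (rule sum.mono_neutral_left) auto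
  then have "of_int (monomial_weight n \<alpha>) =
      of_nat n * (\<Sum>i=0..n. ?l i) - 2 * (\<Sum>i=0..n. of_nat i * ?l i)"
    by (simp add: monomial_weight_def)
  also have "\<dots> = (\<Sum>i=0..n. of_nat n * ?l i - 2 * (of_nat i * ?l i))"
    by (simp only: sum_subtractf sum_distrib_left)
  also have "\<dots> = (\<Sum>i=0..n. (of_nat n + - 2 * of_nat i) * ?l i)"
    by (rule sum.cong) (simp_all add: algebra_simps)
  also have "\<dots> = grade (of_nat n) (-2) \<alpha>"
    unfolding grade_def
    by (rule sum.mono_neutral_right) (use assms in \<open>auto simp: in_keys_iff\<close>)
  finally show ?thesis
    by (rule sym)
qed

lemma isobaric_weight:
  assumes "isobaric n z" "\<alpha> \<in> Poly_Mapping.keys z"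
  shows "monomial_weight n \<alpha> = weight n z"
proof -
  have "weight n z = monomial_weight n \<alpha>"
    unfolding weight_def
    by (rule the_equality) (use assms in \<open>unfold isobaric_def, blast, metis\<close>)
  then show ?thesis
    by simp
qed

lemma isobaric_weight_eigenvector:
  assumes "isobaric n z" "z \<in> polys n"
  shows "grading_derivation (of_nat n) (-2) z = scale (of_int (weight n z)) z"
  unfolding grading_eigenvector_iff
  using assms by (auto simp: isobaric_weight grade_monomial_weight polys_def)


section \<open>The action of the Lie algebra\<close>

text \<open>
  On \<open>x\<^sub>i\<close> the two compositions are \<open>(i + 1) (n - i)\<close> and \<open>i (n + 1 - i)\<close>, which differ by
  \<open>n - 2 i\<close>; this is what the coefficients of \<open>dh\<close> are made for.
\<close>

lemma commutator_weitzenboeck_hat: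
  assumes d: "is_weitzenboeck n d" and dh: "is_hat_derivation n dh" and p: "p \<in> polys n"
  shows "d (dh p) = grading_derivation (of_nat n) (-2) p + dh (d p)"
proof -
  have D: "is_derivation n d" and d0: "d (X 0) = 0"
    and dX: "\<And>i. i < n \<Longrightarrow> d (X (Suc i)) = X i"
    using d by (auto simp: is_weitzenboeck_def)
  have DH: "is_derivation n dh" and dhn: "dh (X n) = 0"
    and dhX: "\<And>i. i < n \<Longrightarrow> dh (X i) = scale (of_nat ((i + 1) * (n - i))) (X (Suc i))"
    using dh by (auto simp: is_hat_derivation_def)
  have up: "d (dh (X i)) = scale (of_nat ((i + 1) * (n - i))) (X i)" if "i \<le> n" for i
    using that
    by (cases "i = n") (simp_all add: dhn dhX derivation_0[OF D] derivation_scale[OF D] dX X_polys)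
  have down: "dh (d (X i)) = scale (of_nat (i * (n + 1 - i))) (X i)" if "i \<le> n" for i
  proof (cases i)
    case 0
    then show ?thesis
      by (simp add: d0 derivation_0[OF DH])
  next
    case (Suc j)
    then show ?thesis
      using that by (simp add: dX dhX)
  qed
  have "d (dh p) - dh (d p) = grading_derivation (of_nat n) (-2) p"
    using is_derivation_commutator[OF D DH] is_derivation_grading _ p
  proof (rule derivations_eqI)
    fix i assume i: "i \<le> n"
    then obtain k where "n = i + k"
      using le_Suc_ex by blast
    then have "of_nat ((i + 1) * (n - i)) - of_nat (i * (n + 1 - i)) =
        (of_nat n + - 2 * of_nat i :: 'a)"
      by (simp add: algebra_simps)
    then show "d (dh (X i)) - dh (d (X i)) = grading_derivation (of_nat n) (-2) (X i)"
      using i by (simp only: up down grading_derivation_X polyspace.scale_left_diff_distrib[symmetric])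
  qed
  then show ?thesis
    by (simp add: algebra_simps)
qed

lemma commutator_grading_hat:
  assumes dh: "is_hat_derivation n dh" and p: "p \<in> polys n"
  shows "grading_derivation a b (dh p) = scale b (dh p) + dh (grading_derivation a b p)"
proof -
  let ?T = "grading_derivation a b"
  have DH: "is_derivation n dh" and dhn: "dh (X n) = 0"
    and dhX: "\<And>i. i < n \<Longrightarrow> dh (X i) = scale (of_nat ((i + 1) * (n - i))) (X (Suc i))"
    using dh by (auto simp: is_hat_derivation_def)
  have T: "is_derivation n ?T"
    by (rule is_derivation_grading)
  have "?T (dh p) - dh (?T p) = scale b (dh p)"
    using is_derivation_commutator[OF T DH] is_derivation_scale[OF DH] _ p
  proof (rule derivations_eqI)
    fix i assume i: "i \<le> n"
    show "?T (dh (X i)) - dh (?T (X i)) = scale b (dh (X i))"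
    proof (cases "i = n")
      case True
      then show ?thesis
        by (simp add: dhn derivation_0[OF T] grading_derivation_X derivation_scale[OF DH] X_polys)
    next
      case False
      with i have "i < n"
        by simp
      then have "?T (dh (X i)) = scale (a + b * of_nat (Suc i)) (dh (X i))"
        by (simp add: dhX derivation_scale[OF T] X_polys grading_derivation_X mult.commute
            del: of_nat_Suc of_nat_mult)
      moreover have "dh (?T (X i)) = scale (a + b * of_nat i) (dh (X i))"
        using i by (simp add: derivation_scale[OF DH] X_polys grading_derivation_X)
      ultimately show ?thesis
        by (simp add: polyspace.scale_left_diff_distrib[symmetric] distrib_left)
    qed
  qed
  then show ?thesis
    by (simp add: algebra_simps)
qed

lemma grading_funpow_hat:
  assumes dh: "is_hat_derivation n dh" and z: "z \<in> polys n"
    and eigen: "grading_derivation a b z = scale l z"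
  shows "grading_derivation a b ((dh ^^ i) z) = scale (l + of_nat i * b) ((dh ^^ i) z)"
proof (induction i)
  case (Suc i)
  have DH: "is_derivation n dh"
    using dh by (simp add: is_hat_derivation_def)
  have "grading_derivation a b ((dh ^^ Suc i) z) = scale (b + (l + of_nat i * b)) ((dh ^^ Suc i) z)"
    using Suc derivation_funpow_closed[OF DH z, of i]
    by (simp add: commutator_grading_hat[OF dh] derivation_scale[OF DH]
        flip: polyspace.scale_left_distrib)
  also have "b + (l + of_nat i * b) = l + of_nat (Suc i) * b"
    by (simp add: algebra_simps)
  finally show ?case .
qed (simp add: eigen)

text \<open>
  Moving \<open>d\<close> past the powers of \<open>dh\<close> one by one collects the weights \<open>w, w - 2, \<dots>, w - 2 i\<close>
  of the intermediate vectors, whose sum is \<open>(i + 1) (w - i)\<close>.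
\<close>

lemma weitzenboeck_funpow_hat:
  assumes d: "is_weitzenboeck n d" and dh: "is_hat_derivation n dh" and z: "z \<in> polys n"
    and eigen: "grading_derivation (of_nat n) (-2) z = scale w z" and dz: "d z = 0"
  shows "d ((dh ^^ Suc i) z) = scale (of_nat (Suc i) * (w - of_nat i)) ((dh ^^ i) z)"
proof (induction i)
  case 0
  have "is_derivation n dh"
    using dh by (simp add: is_hat_derivation_def)
  then show ?case
    by (simp add: commutator_weitzenboeck_hat[OF d dh z] eigen dz derivation_0)
next
  case (Suc i)
  have DH: "is_derivation n dh"
    using dh by (simp add: is_hat_derivation_def)
  let ?y = "(dh ^^ Suc i) z"
  have "d ((dh ^^ Suc (Suc i)) z) =
      scale (w + of_nat (Suc i) * (-2)) ?y + scale (of_nat (Suc i) * (w - of_nat i)) ?y"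
    using Suc commutator_weitzenboeck_hat[OF d dh derivation_funpow_closed[OF DH z, of "Suc i"]]
      grading_funpow_hat[OF dh z eigen, of "Suc i"]
    by (simp add: derivation_scale[OF DH] derivation_funpow_closed[OF DH z])
  also have "\<dots> = scale (of_nat (Suc (Suc i)) * (w - of_nat (Suc i))) ?y"
    unfolding polyspace.scale_left_distrib[symmetric]
    by (rule arg_cong[of _ _ "\<lambda>c. scale c _"]) (simp add: algebra_simps)
  finally show ?case .
qed


section \<open>The order equals the weight\<close>

text \<open>
  All monomials of \<open>z\<close> have the same grade \<open>N\<close> when \<open>x\<^sub>i\<close> counts \<open>n - i\<close>.  Each application of
  \<open>dh\<close> lowers this grade by one, so after \<open>N + 1\<close> applications it would be \<open>-1\<close>.
\<close>

lemma hat_nilpotent: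
  fixes z :: "'k::field_char_0 polynomial"
  assumes dh: "is_hat_derivation n dh" and z: "z \<in> polys n" and iso: "isobaric n z"
  shows "\<exists>i. (dh ^^ i) z = 0"
proof (cases "z = 0")
  case True
  then have "(dh ^^ 0) z = 0"
    by simp
  then show ?thesis
    by (rule exI)
next
  case False
  have DH: "is_derivation n dh"
    using dh by (simp add: is_hat_derivation_def)
  define N where "N \<alpha> = (\<Sum>i\<in>Poly_Mapping.keys \<alpha>. (n - i) * Poly_Mapping.lookup \<alpha> i)"
    for \<alpha> :: monomial
  have grade_N: "grade (of_nat n) (-1) \<alpha> = (of_nat (N \<alpha>) :: 'k)"
    if "\<alpha> \<in> Poly_Mapping.keys p" "p \<in> polys n" for \<alpha> and p :: "'k polynomial"
    unfolding grade_def N_def of_nat_sum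
    by (rule sum.cong) (use that in \<open>auto simp: polys_def of_nat_diff subset_iff\<close>)
  \<comment> \<open>Since \<open>2 * (n - i) = (n - 2 * i) + n\<close>, this grade is determined by weight and degree.\<close>
  have double: "2 * grade (of_nat n) (-1) \<alpha> =
      (of_int (weight n z) + of_nat (n * monomial_degree \<alpha>) :: 'k)"
    if "\<alpha> \<in> Poly_Mapping.keys z" for \<alpha>
  proof -
    have "2 * grade (of_nat n) (-1) \<alpha> =
        (grade (of_nat n) (-2) \<alpha> + of_nat (n * monomial_degree \<alpha>) :: 'k)"
      by (simp add: grade_def monomial_degree_def sum_distrib_left sum.distrib[symmetric] algebra_simps)
    then show ?thesis
      using that z iso by (simp add: grade_monomial_weight isobaric_weight polys_def)
  qed
  from False obtain \<alpha> where \<alpha>: "\<alpha> \<in> Poly_Mapping.keys z"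
    by fastforce
  have "grading_derivation (of_nat n) (-1) z = scale (of_nat (N \<alpha>)) z"
    unfolding grading_eigenvector_iff
  proof
    fix \<beta> assume \<beta>: "\<beta> \<in> Poly_Mapping.keys z"
    then have "monomial_degree \<beta> = monomial_degree \<alpha>"
      using \<alpha> iso unfolding isobaric_def homogeneous_def by blast
    then have "2 * grade (of_nat n) (-1) \<beta> = (2 * grade (of_nat n) (-1) \<alpha> :: 'k)"
      by (simp only: double[OF \<alpha>] double[OF \<beta>])
    then show "grade (of_nat n) (-1) \<beta> = (of_nat (N \<alpha>) :: 'k)"
      using grade_N[OF \<alpha> z] by simp
  qed
  from grading_funpow_hat[OF dh z this, of "Suc (N \<alpha>)"]
  have eigen: "grading_derivation (of_nat n) (-1) ((dh ^^ Suc (N \<alpha>)) z) =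
      scale (-1) ((dh ^^ Suc (N \<alpha>)) z)"
    by simp
  have "(dh ^^ Suc (N \<alpha>)) z = 0"
  proof (rule ccontr)
    assume "(dh ^^ Suc (N \<alpha>)) z \<noteq> 0"
    then obtain \<beta> where \<beta>: "\<beta> \<in> Poly_Mapping.keys ((dh ^^ Suc (N \<alpha>)) z)"
      using keys_eq_empty by blast
    have "of_nat (N \<beta>) = (-1 :: 'k)"
      using grade_N[OF \<beta> derivation_funpow_closed[OF DH z]] eigen \<beta>
      unfolding grading_eigenvector_iff by metis
    then have "of_nat (Suc (N \<beta>)) = (0 :: 'k)"
      by simp
    then show False
      by (simp only: of_nat_eq_0_iff)
  qed
  then show ?thesis
    by (rule exI)
qed

text \<open>
  Nilpotency guarantees that the \<open>LEAST\<close> in the definition of the order is taken over a nonempty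
  set; the factor \<open>w - s\<close> must then account for the vanishing of \<open>d (dh\<^sup>s\<^sup>+\<^sup>1 z)\<close>.
\<close>

lemma poly_order_eq_weight:
  fixes z :: "'k::field_char_0 polynomial"
  assumes d: "is_weitzenboeck n d" and dh: "is_hat_derivation n dh" and z: "z \<in> polys n"
    and nz: "z \<noteq> 0" and iso: "isobaric n z" and dz: "d z = 0"
  shows "weight n z = int (poly_order dh z)"
proof -
  let ?s = "poly_order dh z"
  define i where "i = (LEAST i. (dh ^^ i) z = 0)"
  have zero: "(dh ^^ i) z = 0"
    unfolding i_def by (rule LeastI_ex) (rule hat_nilpotent[OF dh z iso])
  with nz have "0 < i"
    by (cases i) auto
  then have "(dh ^^ (i - 1)) z \<noteq> 0"
    using not_less_Least[of "i - 1" "\<lambda>i. (dh ^^ i) z = 0"] unfolding i_def[symmetric] by simp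
  with zero \<open>0 < i\<close> have "(dh ^^ (i - 1)) z \<noteq> 0 \<and> (dh ^^ (i - 1 + 1)) z = 0"
    by simp
  then have s: "(dh ^^ ?s) z \<noteq> 0 \<and> (dh ^^ (?s + 1)) z = 0"
    unfolding poly_order_def by (rule LeastI)
  have "is_derivation n d"
    using d by (simp add: is_weitzenboeck_def)
  then have "scale (of_nat (Suc ?s) * (of_int (weight n z) - of_nat ?s)) ((dh ^^ ?s) z) = 0"
    using weitzenboeck_funpow_hat[OF d dh z isobaric_weight_eigenvector[OF iso z] dz, of ?s] s
    by (simp add: derivation_0)
  then have "of_int (weight n z) = (of_int (int ?s) :: 'k)"
    using s by (simp del: of_nat_Suc)
  then show ?thesis
    by (simp only: of_int_eq_iff)
qed


section \<open>Jordan chains\<close>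

locale jordan_chain =
  fixes n m :: nat and d :: "'k::field polynomial \<Rightarrow> 'k polynomial" and v :: "nat \<Rightarrow> 'k polynomial"
  assumes derivation: "is_derivation n d"
    and closed: "\<And>i. i \<le> m \<Longrightarrow> v i \<in> polys n"
    and kernel: "d (v 0) = 0"
    and step: "\<And>i. i < m \<Longrightarrow> d (v (Suc i)) = v i"
    and nonzero: "v 0 \<noteq> 0"
begin

definition comb :: "(nat \<Rightarrow> 'k) \<Rightarrow> 'k polynomial" where
  "comb a = (\<Sum>i\<le>m. scale (a i) (v i))"

lemma comb_add: "comb a + comb b = comb (\<lambda>i. a i + b i)"
  by (simp add: comb_def sum.distrib polyspace.scale_left_distrib)

lemma comb_scale: "scale c (comb a) = comb (\<lambda>i. c * a i)"
  by (simp add: comb_def polyspace.scale_sum_right)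

lemma comb_diff: "comb a - comb b = comb (\<lambda>i. a i - b i)"
  by (simp add: comb_def sum_subtractf polyspace.scale_left_diff_distrib)

lemma d_comb: "d (comb a) = comb (\<lambda>i. if i < m then a (Suc i) else 0)"
proof -
  have "d (comb a) = (\<Sum>i\<le>m. scale (a i) (d (v i)))"
    unfolding comb_def
    by (subst derivation_sum[OF derivation])
      (auto simp: derivation_scale[OF derivation] closed intro!: polys_scale)
  also have "\<dots> = (\<Sum>i<m. scale (a (Suc i)) (v i))"
    by (simp add: sum.atMost_shift kernel step)
  also have "\<dots> = comb (\<lambda>i. if i < m then a (Suc i) else 0)"
    unfolding comb_def by (rule sum.mono_neutral_cong_left) auto
  finally show ?thesis .
qed

text \<open>
  Applying \<open>d\<close> shortens a vanishing combination by one term and shifts its coefficients.  This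
  drives an induction on a bound \<open>j\<close> for the indices of the nonzero coefficients; in the end only
  the multiple of \<open>v 0\<close> is left.
\<close>

lemma comb_eq_0D:
  assumes "comb a = 0" "i \<le> m"
  shows "a i = 0"
proof -
  have "\<forall>i\<le>m. a i = 0" if "comb a = 0" "\<forall>i\<le>m. j < i \<longrightarrow> a i = 0" for j a
    using that
  proof (induction j arbitrary: a)
    case 0
    have "comb a = (\<Sum>i\<in>{0}. scale (a i) (v i))"
      unfolding comb_def by (rule sum.mono_neutral_right) (use 0 in auto)
    with 0 nonzero have "a 0 = 0"
      by simp
    with 0 show ?case
      by (metis gr0I)
  next
    case (Suc j)
    let ?b = "\<lambda>i. if i < m then a (Suc i) else 0"
    have "comb ?b = d (comb a)"
      by (rule d_comb[symmetric])
    also have "\<dots> = 0"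
      unfolding Suc.prems(1) by (rule derivation_0[OF derivation])
    finally have b_0: "comb ?b = 0" .
    have b: "\<forall>i\<le>m. ?b i = 0"
      by (rule Suc.IH[OF b_0]) (use Suc.prems in simp)
    have "\<forall>i\<le>m. j < i \<longrightarrow> a i = 0"
    proof (intro allI impI)
      fix i assume "i \<le> m" "j < i"
      then show "a i = 0"
        using b[rule_format, of "i - 1"] by (cases i) simp_all
    qed
    then show ?case
      using Suc by blast
  qed
  from this[of a m] assms show ?thesis
    by auto
qed

lemma comb_inject: "comb a = comb b \<Longrightarrow> i \<le> m \<Longrightarrow> a i = b i"
  using comb_eq_0D[of "\<lambda>i. a i - b i" i] comb_diff[of a b] by simp

lemma comb_cong: "(\<And>i. i \<le> m \<Longrightarrow> a i = b i) \<Longrightarrow> comb a = comb b"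
  by (simp add: comb_def)

lemma span_eq: "poly_span (v ` {0..m}) = range comb"
proof (intro subset_antisym polyspace.span_minimal)
  have "v i \<in> range comb" if "i \<le> m" for i
  proof -
    have "comb (\<lambda>j. if j = i then 1 else 0) = (\<Sum>j\<le>m. if j = i then v j else 0)"
      unfolding comb_def by (rule sum.cong) auto
    also have "\<dots> = v i"
      using that by simp
    finally show ?thesis
      by (metis rangeI)
  qed
  then show "v ` {0..m} \<subseteq> range comb"
    by auto
  have "comb (\<lambda>i. 0) = 0"
    by (simp add: comb_def)
  then show "poly_subspace (range comb)"
    unfolding polyspace.subspace_def by (auto simp: comb_add comb_scale intro: range_eqI[OF sym])
  show "range comb \<subseteq> poly_span (v ` {0..m})"
    unfolding comb_def
    by (rule image_subsetI, rule polyspace.span_sum, rule polyspace.span_scale,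
        rule polyspace.span_base) simp
qed

lemma d_module: "d_module d (poly_span (v ` {0..m}))"
  unfolding d_module_def by (auto simp: span_eq d_comb polyspace.subspace_span[of "v ` {0..m}", unfolded span_eq])

end

text \<open>
  By linear independence the coordinates with respect to the first chain are well defined, and in
  these coordinates both operators are the same shift.
\<close>

lemma jordan_chains_isomorphic:
  assumes "jordan_chain n m d v" and "jordan_chain n' m d' v'"
  shows "d_module_iso d (poly_span (v ` {0..m})) d' (poly_span (v' ` {0..m}))"
proof -
  interpret V: jordan_chain n m d v by fact
  interpret W: jordan_chain n' m d' v' by fact
  define f where "f u = W.comb (SOME a. u = V.comb a)" for u
  have f: "f (V.comb a) = W.comb a" for a
  proof -
    have "V.comb a = V.comb (SOME b. V.comb a = V.comb b)"
      by (rule someI[of "\<lambda>b. V.comb a = V.comb b" a]) (rule refl)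
    then show ?thesis
      unfolding f_def by (metis W.comb_cong V.comb_inject)
  qed
  have "bij_betw f (range V.comb) (range W.comb)"
  proof (rule bij_betw_imageI)
    show "inj_on f (range V.comb)"
    proof (rule inj_onI, clarify)
      fix a b assume "f (V.comb a) = f (V.comb b)"
      then have "W.comb a = W.comb b"
        by (simp only: f)
      then show "V.comb a = V.comb b"
        by (intro V.comb_cong W.comb_inject)
    qed
    show "f ` range V.comb = range W.comb"
      by (simp add: image_image f)
  qed
  then show ?thesis
    unfolding d_module_iso_def
    by (intro conjI V.d_module W.d_module exI[of _ f])
      (auto simp: V.span_eq W.span_eq f V.comb_add W.comb_add V.comb_scale W.comb_scale
        V.d_comb W.d_comb)
qed

lemma variables_jordan_chain:
  assumes "is_weitzenboeck m d"
  shows "jordan_chain m m d X"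
proof
  show "X 0 \<noteq> (0 :: 'a polynomial)"
    by (metis X_def lookup_single_eq lookup_zero zero_neq_one)
qed (use assms in \<open>auto simp: is_weitzenboeck_def X_polys\<close>)

text \<open>
  With the weight replaced by the order \<open>s\<close>, the step reduces to the identity
  \<open>(s - i - 1)! / ((i + 1)! s!) * (i + 1) (s - i) = (s - i)! / (i! s!)\<close>.
\<close>

lemma v_elem_jordan_chain:
  fixes z :: "'k::field_char_0 polynomial"
  assumes d: "is_weitzenboeck n d" and dh: "is_hat_derivation n dh" and z: "z \<in> polys n"
    and nz: "z \<noteq> 0" and iso: "isobaric n z" and dz: "d z = 0" and m: "m \<le> poly_order dh z"
  shows "jordan_chain n m d (v_elem n dh z)"
proof
  let ?s = "poly_order dh z"
  have w: "weight n z = int ?s"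
    by (rule poly_order_eq_weight[OF d dh z nz iso dz])
  have v: "v_elem n dh z i = scale (fact (?s - i) / (fact i * fact ?s)) ((dh ^^ i) z)" for i
    by (simp only: v_elem_def w nat_minus_as_int nat_int)
  have D: "is_derivation n d" and DH: "is_derivation n dh"
    using d dh by (auto simp: is_weitzenboeck_def is_hat_derivation_def)
  show "is_derivation n d"
    by (rule D)
  show "v_elem n dh z i \<in> polys n" for i
    by (simp add: v polys_scale derivation_funpow_closed[OF DH z])
  show "d (v_elem n dh z 0) = 0" "v_elem n dh z 0 \<noteq> 0"
    by (simp_all add: v dz nz)
  show "d (v_elem n dh z (Suc i)) = v_elem n dh z i" if "i < m" for i
  proof -
    have s: "?s - i = Suc (?s - Suc i)" "i \<le> ?s"
      using that m by auto
    have c: "fact (?s - Suc i) / (fact (Suc i) * fact ?s) * (of_nat (Suc i) * (of_nat ?s - of_nat i)) =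
        (fact (?s - i) / (fact i * fact ?s) :: 'k)"
      using s(1) by (simp add: of_nat_diff[OF s(2), symmetric] divide_simps del: of_nat_Suc of_nat_diff)
    show ?thesis
      using weitzenboeck_funpow_hat[OF d dh z isobaric_weight_eigenvector[OF iso z] dz, of i]
        derivation_funpow_closed[OF DH z, of "Suc i"]
      by (simp only: v derivation_scale[OF D] w of_int_of_nat_eq polyspace.scale_scale c)
  qed
qed

theorem theorem3p2:
  fixes n m :: nat
    and d dh d_m :: "'k::field_char_0 polynomial \<Rightarrow> 'k polynomial"
    and z :: "'k polynomial"
  assumes "is_weitzenboeck n d"
    and "is_hat_derivation n dh"
    and "is_weitzenboeck m d_m"
    and "z \<in> polys n" and "z \<noteq> 0"
    and "homogeneous z" and "isobaric n z"
    and "d z = 0"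
    and "m \<le> poly_order dh z"
  shows "d_module d (V_module n dh z m) \<and>
         d_module_iso d_m (X_module m) d (V_module n dh z m)"
proof -
  have v: "jordan_chain n m d (v_elem n dh z)"
    using assms by (intro v_elem_jordan_chain)
  show ?thesis
    unfolding V_module_def X_module_def
    using jordan_chain.d_module[OF v]
      jordan_chains_isomorphic[OF variables_jordan_chain[OF assms(3)] v] by blast
qed

end
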